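(* There are fine ultrafilters $\mathcal{U}$ on $[V]^{<\omega}$ such that $\mathsf{Pr}_{\mathcal{U}}$ is superregular and, for every diagonal random variable $\theta$: (1) $\mathsf{Pr}_{\mathcal{U}}(\theta\in\mathrm{On})\approx 0$; (2) $\mathsf{Pr}_{\mathcal{U}}(\theta\in\mathrm{Even}\mid\theta\in\mathrm{On})\approx \tfrac12$; (3) $\mathsf{Pr}_{\mathcal{U}}(\theta\in\mathrm{Lim}\mid\theta\in\mathrm{On})\approx 0$.
   Context: $V$ is the set-theoretic universe; $[V]^{<\omega}$ is the collection of finite subsets of $V$. $\mathrm{On}$ is the class of ordinals, $\mathrm{Lim}$ the class of limit ordinals, and $\mathrm{Even}$ the class of even ordinals, i.e. ordinals of the form $\lambda+2n$ with $\lambda$ zero or a limit ordinal and $n\in\omega$. An ultrafilter $\mathcal{U}$ on $[V]^{<\omega}$ is fine if for every $x\in V$, $\{T\in[V]^{<\omega}: x\in T\}\in\mathcal{U}$. Functions $[V]^{<\omega}\to\mathbb{Q}$ modulo agreement on a set in $\mathcal{U}$ form an ordered hyper-rational field $\mathcal{F}_{\mathcal{U}}$. A random variable is a class function $\tau:V\to V$; it is diagonal if every set is the value of $\tau$ at exactly one argument. For a class $A$, $\mathsf{Pr}_{\mathcal{U}}(\tau\in A)=[T\mapsto |\{s\in T:\tau(s)\in A\}|/|T|]_{\mathcal{U}}$, and $\mathsf{Pr}_{\mathcal{U}}(\tau\in A\mid\tau\in B)=\mathsf{Pr}_{\mathcal{U}}(\tau\in A\cap B)/\mathsf{Pr}_{\mathcal{U}}(\tau\in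 B)$. For $p,q\in\mathcal{F}_{\mathcal{U}}$: $p\approx q$ means $|p-q|<1/n$ for all positive integers $n$; for $q>0$, $p\ll q$ means $p/q\approx 0$. $\mathsf{Pr}_{\mathcal{U}}$ is superregular if for every diagonal $\theta$ and all classes $A,B\subseteq V$ with $\omega\leq|A|<|B|\leq|V|$ (a proper class having size $|V|$, larger than any set), $\mathsf{Pr}_{\mathcal{U}}(\theta\in A)\ll\mathsf{Pr}_{\mathcal{U}}(\theta\in B)$.
   Formalization: No single U satisfies (2) for all diagonal θ (three disjoint classes of ordinals would each get probability ≈ 1/2 given On), so the formal theorem says: for every diagonal θ there is a fine U, with Pr_U superregular, satisfying (1)–(3) for that θ. *)

theory Defs
  imports Complex_Main "HOL-Library.FSet" "HOL-Library.Equipollence"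
begin

section \<open>The universe of sets\<close>

text \<open>
  The universe \<open>V\<close> is a type \<open>'v\<close> with a membership relation \<open>mem\<close>; a class is an arbitrary
  \<open>'v set\<close> and a class function an arbitrary function \<open>'v \<Rightarrow> 'v\<close>. Since separation, replacement
  and foundation range over all of these, and the choice operator of HOL provides a global choice
  function, every proper class is equipollent to \<open>V\<close> and larger than every set.
\<close>

locale zfc_universe =
  fixes mem :: "'v \<Rightarrow> 'v \<Rightarrow> bool"
  assumes extensionality: "(\<And>z. mem z x \<longleftrightarrow> mem z y) \<Longrightarrow> x = y"
    and foundation: "A \<noteq> {} \<Longrightarrow> \<exists>x\<in>A. \<forall>y. mem y x \<longrightarrow> y \<notin> A"
    and pairing: "\<exists>p. \<forall>z. mem z p \<longleftrightarrow> z = x \<or> z = y"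
    and union: "\<exists>u. \<forall>z. mem z u \<longleftrightarrow> (\<exists>y. mem y x \<and> mem z y)"
    and powerset: "\<exists>p. \<forall>z. mem z p \<longleftrightarrow> (\<forall>y. mem y z \<longrightarrow> mem y x)"
    and infinity: "\<exists>w. (\<exists>e. mem e w \<and> (\<forall>z. \<not> mem z e)) \<and>
      (\<forall>x. mem x w \<longrightarrow> (\<exists>s. mem s w \<and> (\<forall>z. mem z s \<longleftrightarrow> mem z x \<or> z = x)))"
    and separation: "\<exists>s. \<forall>z. mem z s \<longleftrightarrow> mem z x \<and> z \<in> A"
    and replacement: "\<exists>r. \<forall>z. mem z r \<longleftrightarrow> (\<exists>y. mem y x \<and> z = F y)"

definition transitive_set :: "('v \<Rightarrow> 'v \<Rightarrow> bool) \<Rightarrow> 'v \<Rightarrow> bool" where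
  "transitive_set mem x \<longleftrightarrow> (\<forall>y z. mem y x \<longrightarrow> mem z y \<longrightarrow> mem z x)"

text \<open>By foundation, the ordinals are the transitive sets of transitive sets.\<close>

definition On :: "('v \<Rightarrow> 'v \<Rightarrow> bool) \<Rightarrow> 'v set" where
  "On mem = {\<alpha>. transitive_set mem \<alpha> \<and> (\<forall>\<beta>. mem \<beta> \<alpha> \<longrightarrow> transitive_set mem \<beta>)}"

definition set_succ :: "('v \<Rightarrow> 'v \<Rightarrow> bool) \<Rightarrow> 'v \<Rightarrow> 'v" where
  "set_succ mem x = (THE s. \<forall>z. mem z s \<longleftrightarrow> mem z x \<or> z = x)"

definition Zero :: "('v \<Rightarrow> 'v \<Rightarrow> bool) \<Rightarrow> 'v set" where
  "Zero mem = {\<alpha>. \<forall>z. \<not> mem z \<alpha>}"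

definition Limits :: "('v \<Rightarrow> 'v \<Rightarrow> bool) \<Rightarrow> 'v set" where
  "Limits mem = {\<alpha> \<in> On mem. \<alpha> \<notin> Zero mem \<and> (\<forall>\<beta>\<in>On mem. \<alpha> \<noteq> set_succ mem \<beta>)}"

text \<open>The ordinal \<open>\<delta> + n\<close> is the \<open>n\<close>-th iterated successor of \<open>\<delta>\<close>.\<close>

definition Even :: "('v \<Rightarrow> 'v \<Rightarrow> bool) \<Rightarrow> 'v set" where
  "Even mem = {(set_succ mem ^^ (2 * n)) \<delta> | \<delta> n. \<delta> \<in> Zero mem \<union> Limits mem}"


section \<open>Ultrafilters\<close>

text \<open>
  An ultrafilter on a type is given as a filter, with \<open>eventually P U\<close> meaning that
  \<open>{T. P T}\<close> belongs to it. The type \<open>'v fset\<close> is the collection of finite subsets of \<open>V\<close>.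
\<close>

definition ultrafilter :: "'i filter \<Rightarrow> bool" where
  "ultrafilter U \<longleftrightarrow>
     U \<noteq> bot \<and> (\<forall>P. eventually P U \<or> eventually (\<lambda>T. \<not> P T) U)"

definition fine :: "'v fset filter \<Rightarrow> bool" where
  "fine U \<longleftrightarrow> (\<forall>x. \<forall>\<^sub>F T in U. x |\<in>| T)"


section \<open>Hyper-rationals\<close>

text \<open>
  The field depends on the filter and so cannot be a type: its elements are the classes
  \<open>hrat U f\<close> of the functions \<open>f\<close>. Operations take the union, over all representatives, of
  the resulting class; by the lemmas below this does not depend on the representatives.
\<close>

definition agree :: "'i filter \<Rightarrow> (('i \<Rightarrow> rat) \<times> ('i \<Rightarrow> rat)) set" where
  "agree U = {(f, g). \<forall>\<^sub>F T in U. f T = g T}"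

type_synonym 'i hrat = "('i \<Rightarrow> rat) set"

definition hrat :: "'i filter \<Rightarrow> ('i \<Rightarrow> rat) \<Rightarrow> 'i hrat" where
  "hrat U f = agree U `` {f}"

definition hconst :: "'i filter \<Rightarrow> rat \<Rightarrow> 'i hrat" where
  "hconst U r = hrat U (\<lambda>_. r)"

definition hminus :: "'i filter \<Rightarrow> 'i hrat \<Rightarrow> 'i hrat \<Rightarrow> 'i hrat" where
  "hminus U p q = (\<Union>f\<in>p. \<Union>g\<in>q. hrat U (\<lambda>T. f T - g T))"

definition hdivide :: "'i filter \<Rightarrow> 'i hrat \<Rightarrow> 'i hrat \<Rightarrow> 'i hrat" where
  "hdivide U p q = (\<Union>f\<in>p. \<Union>g\<in>q. hrat U (\<lambda>T. f T / g T))"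

definition habs :: "'i filter \<Rightarrow> 'i hrat \<Rightarrow> 'i hrat" where
  "habs U p = (\<Union>f\<in>p. hrat U (\<lambda>T. \<bar>f T\<bar>))"

definition hless :: "'i filter \<Rightarrow> 'i hrat \<Rightarrow> 'i hrat \<Rightarrow> bool" where
  "hless U p q \<longleftrightarrow> (\<exists>f\<in>p. \<exists>g\<in>q. \<forall>\<^sub>F T in U. f T < g T)"

definition happrox :: "'i filter \<Rightarrow> 'i hrat \<Rightarrow> 'i hrat \<Rightarrow> bool" where
  "happrox U p q \<longleftrightarrow> (\<forall>n::nat. n > 0 \<longrightarrow> hless U (habs U (hminus U p q)) (hconst U (1 / of_nat n)))"

definition hmuch_less :: "'i filter \<Rightarrow> 'i hrat \<Rightarrow> 'i hrat \<Rightarrow> bool" where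
  "hmuch_less U p q \<longleftrightarrow> hless U (hconst U 0) q \<and> happrox U (hdivide U p q) (hconst U 0)"

lemma equiv_agree: "equiv UNIV (agree U)"
proof (rule equivI)
  show "refl (agree U)" by (simp add: agree_def refl_on_def)
  show "sym (agree U)" by (auto simp: agree_def sym_def elim: eventually_mono)
  show "trans (agree U)" unfolding agree_def trans_def by (auto elim: eventually_elim2)
qed simp

lemma hrat_eqI: "\<forall>\<^sub>F T in U. f T = g T \<Longrightarrow> hrat U f = hrat U g"
  unfolding hrat_def by (rule equiv_class_eq[OF equiv_agree]) (simp add: agree_def)

lemma mem_hrat: "g \<in> hrat U f \<longleftrightarrow> (\<forall>\<^sub>F T in U. f T = g T)"
  by (simp add: hrat_def agree_def)

lemma hminus_hrat: "hminus U (hrat U f) (hrat U g) = hrat U (\<lambda>T. f T - g T)"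
proof -
  have "hrat U (\<lambda>T. f' T - g' T) = hrat U (\<lambda>T. f T - g T)"
    if "f' \<in> hrat U f" "g' \<in> hrat U g" for f' g'
    using that unfolding mem_hrat by (intro hrat_eqI) (auto elim: eventually_elim2)
  moreover have "f \<in> hrat U f" "g \<in> hrat U g" by (simp_all add: mem_hrat)
  ultimately show ?thesis unfolding hminus_def by blast
qed

lemma hdivide_hrat: "hdivide U (hrat U f) (hrat U g) = hrat U (\<lambda>T. f T / g T)"
proof -
  have "hrat U (\<lambda>T. f' T / g' T) = hrat U (\<lambda>T. f T / g T)"
    if "f' \<in> hrat U f" "g' \<in> hrat U g" for f' g'
    using that unfolding mem_hrat by (intro hrat_eqI) (auto elim: eventually_elim2)
  moreover have "f \<in> hrat U f" "g \<in> hrat U g" by (simp_all add: mem_hrat)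
  ultimately show ?thesis unfolding hdivide_def by blast
qed

lemma habs_hrat: "habs U (hrat U f) = hrat U (\<lambda>T. \<bar>f T\<bar>)"
proof -
  have "hrat U (\<lambda>T. \<bar>f' T\<bar>) = hrat U (\<lambda>T. \<bar>f T\<bar>)" if "f' \<in> hrat U f" for f'
    using that unfolding mem_hrat by (intro hrat_eqI) (auto elim: eventually_mono)
  moreover have "f \<in> hrat U f" by (simp add: mem_hrat)
  ultimately show ?thesis unfolding habs_def by blast
qed

lemma hless_hrat: "hless U (hrat U f) (hrat U g) \<longleftrightarrow> (\<forall>\<^sub>F T in U. f T < g T)"
proof
  assume "hless U (hrat U f) (hrat U g)"
  then obtain f' g' where f': "f' \<in> hrat U f" and g': "g' \<in> hrat U g"
    and less: "\<forall>\<^sub>F T in U. f' T < g' T"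
    unfolding hless_def by blast
  from f'[unfolded mem_hrat] g'[unfolded mem_hrat] less
  show "\<forall>\<^sub>F T in U. f T < g T" by eventually_elim simp
next
  assume "\<forall>\<^sub>F T in U. f T < g T"
  then show "hless U (hrat U f) (hrat U g)"
    unfolding hless_def by (intro bexI[of _ f] bexI[of _ g]) (simp_all add: mem_hrat)
qed


section \<open>Probabilities of random variables\<close>

definition diagonal :: "('v \<Rightarrow> 'v) \<Rightarrow> bool" where
  "diagonal \<tau> \<longleftrightarrow> (\<forall>y. \<exists>!x. \<tau> x = y)"

definition Pr :: "'v fset filter \<Rightarrow> ('v \<Rightarrow> 'v) \<Rightarrow> 'v set \<Rightarrow> 'v fset hrat" where
  "Pr U \<tau> A = hrat U (\<lambda>T. of_nat (fcard (ffilter (\<lambda>s. \<tau> s \<in> A) T)) / of_nat (fcard T))"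

definition cond_Pr :: "'v fset filter \<Rightarrow> ('v \<Rightarrow> 'v) \<Rightarrow> 'v set \<Rightarrow> 'v set \<Rightarrow> 'v fset hrat" where
  "cond_Pr U \<tau> A B = hdivide U (Pr U \<tau> (A \<inter> B)) (Pr U \<tau> B)"

definition superregular :: "'v fset filter \<Rightarrow> bool" where
  "superregular U \<longleftrightarrow>
     (\<forall>\<theta> A B. diagonal \<theta> \<longrightarrow> (UNIV :: nat set) \<lesssim> A \<longrightarrow> A \<prec> B \<longrightarrow> B \<lesssim> (UNIV :: 'v set) \<longrightarrow>
        hmuch_less U (Pr U \<theta> A) (Pr U \<theta> B))"

end

theory Submission
  imports Defs
begin

text \<open>
  A diagonal \<open>\<theta>\<close> is a bijection of \<open>V\<close>, so preimages under \<open>\<theta>\<close> have the same size as the classes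
  themselves, and all requirements on \<open>\<U>\<close> say that certain collections of finite sets \<open>T\<close> belong
  to it. By the ultrafilter theorem it suffices that finitely many requirements can be met by one
  \<open>T\<close>. For finitely many pairs \<open>|A| < |B|\<close> this is achieved by adding many points of \<open>B\<close> outside of
  the classes not larger than \<open>A\<close>. Every such \<open>A\<close> is smaller than \<open>V\<close>, whereas the even successor
  ordinals, the odd ordinals and the complement of \<open>On\<close> are as large as \<open>V\<close>; so points of these three
  classes can be added afterwards without enlarging any \<open>T \<inter> A\<close>.
\<close>

section \<open>Finite sets with prescribed counts\<close>

lemma lepoll_iff_card_of: "A \<lesssim> B \<longleftrightarrow> ordLeq3 (card_of A) (card_of B)"
  by (simp add: lepoll_def card_of_ordLeq)

text \<open>Choice enters here: cardinals are well-orders, and any two well-orders are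
  comparable.\<close>

lemma not_lepoll_iff_lesspoll: "\<not> A \<lesssim> B \<longleftrightarrow> B \<prec> A"
  using ordLeq_total[OF card_of_Well_order card_of_Well_order, of A B]
  by (metis lepoll_iff_card_of lepoll_antisym lesspoll_def eqpoll_imp_lepoll eqpoll_sym)

lemma lesspoll_iff_card_of: "A \<prec> B \<longleftrightarrow> ordLess2 (card_of A) (card_of B)"
  by (metis not_lepoll_iff_lesspoll lepoll_iff_card_of not_ordLess_iff_ordLeq card_of_Well_order)

lemma lesspoll_imp_infinite:
  assumes "infinite A" "A \<prec> B"
  shows "infinite B"
  using assms finite_lepoll_infinite not_lepoll_iff_lesspoll by blast

lemma Un_lesspoll:
  assumes "infinite C" "A \<prec> C" "B \<prec> C"
  shows "A \<union> B \<prec> C"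
  using assms card_of_Un_ordLess_infinite unfolding lesspoll_iff_card_of by blast

lemma UN_finite_lesspoll:
  assumes "finite I" "infinite C" "\<And>i. i \<in> I \<Longrightarrow> A i \<prec> C"
  shows "(\<Union>i\<in>I. A i) \<prec> C"
  using assms(1,3)
proof (induction I rule: finite_induct)
  case empty
  then show ?case by (simp add: finite_lesspoll_infinite[OF assms(2)])
next
  case (insert i I)
  then show ?case by (simp add: Un_lesspoll[OF assms(2)])
qed

text \<open>An infinite class is not the union of two smaller ones. This is what always leaves room
  for fresh points outside of the classes to be avoided.\<close>

lemma infinite_Diff_lesspoll:
  assumes "infinite B" "C \<prec> B"
  shows "infinite (B - C)"
proof
  assume "finite (B - C)"
  then have "(B - C) \<union> C \<prec> B"
    using assms by (metis Un_lesspoll finite_lesspoll_infinite)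
  then show False
    using subset_imp_lepoll[of B "B - C \<union> C"] not_lepoll_iff_lesspoll by blast
qed

lemma vimage_bij_eqpoll:
  assumes "bij f"
  shows "f -` A \<approx> A"
proof -
  have "f ` (f -` A) = A" using assms by (simp add: bij_is_surj surj_image_vimage_eq)
  moreover have "inj_on f (f -` A)" using assms bij_is_inj inj_on_subset by blast
  ultimately show ?thesis using inj_on_image_eqpoll_self eqpoll_sym by metis
qed

text \<open>Applied to first components, this finds the pair to be treated last in the separation
  argument.\<close>

lemma ex_lepoll_maximal:
  assumes "finite I" "I \<noteq> {}"
  shows "\<exists>m\<in>I. \<forall>i\<in>I. A i \<lesssim> A m"
  using assms
proof (induction I rule: finite_ne_induct)
  case (singleton i)
  then show ?case by simp
next
  case (insert i I)
  then obtain m where m: "m \<in> I" "\<forall>j\<in>I. A j \<lesssim> A m" by blast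
  show ?case
  proof (cases "A i \<lesssim> A m")
    case True
    then show ?thesis using m by blast
  next
    case False
    then have "A m \<lesssim> A i" by (meson not_lepoll_iff_lesspoll lesspoll_imp_lepoll)
    then show ?thesis using m(2) lepoll_trans by blast
  qed
qed

section \<open>Adding fresh points to finite sets\<close>

lemma ex_finite_disjoint_subset:
  assumes "infinite D" "finite T"
  obtains Y where "finite Y" "card Y = m" "Y \<subseteq> D" "Y \<inter> T = {}"
proof -
  obtain Y where "finite Y" "card Y = m" "Y \<subseteq> D - T"
    using infinite_arbitrarily_large[of "D - T" m] assms by auto
  then show thesis using that by blast
qed

text \<open>
  The pairs are treated in order of increasing \<open>A\<close>: the points which are added to enlarge \<open>B\<close>
  then avoid every \<open>A'\<close> treated before, so no inequality achieved before is destroyed.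
\<close>

lemma ex_finite_separating:
  assumes "finite S" "\<And>A B. (A, B) \<in> S \<Longrightarrow> infinite B \<and> A \<prec> B" "finite X"
  shows "\<exists>T. finite T \<and> X \<subseteq> T \<and> (\<forall>(A, B)\<in>S. k * card (T \<inter> A) < card (T \<inter> B))"
  using assms(1,2)
proof (induction S rule: finite_psubset_induct)
  case (psubset S)
  show ?case
  proof (cases "S = {}")
    case True
    then show ?thesis using assms(3) by blast
  next
    case False
    then obtain A B where AB: "(A, B) \<in> S" and max: "\<forall>(A', B')\<in>S. A' \<lesssim> A"
      using ex_lepoll_maximal[OF psubset.hyps(1) False, of fst] by fastforce
    \<comment> \<open>Every first component in \<open>S\<close> is at most as large as
      \<open>A\<close>, so even their union \<open>C\<close> is smaller than
      \<open>B\<close>.\<close>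
    define C where "C = (\<Union>p\<in>S. fst p)"
    have B: "infinite B" "A \<prec> B" using psubset.prems AB by auto
    have "C \<prec> B"
      unfolding C_def using max B lesspoll_trans1 psubset.hyps(1)
      by (intro UN_finite_lesspoll) fastforce+
    then have inf: "infinite (B - C)" using B infinite_Diff_lesspoll by blast
    obtain T where T: "finite T" "X \<subseteq> T"
      "\<forall>(A', B')\<in>S - {(A, B)}. k * card (T \<inter> A') < card (T \<inter> B')"
      using psubset.IH[of "S - {(A, B)}"] AB psubset.prems by blast
    \<comment> \<open>One point more than the factor \<open>k\<close> demands. As \<open>Y\<close>
      avoids \<open>C\<close>, the count on each first component stays the one in
      \<open>T\<close>.\<close>
    obtain Y where Y: "finite Y" "card Y = Suc (k * card (T \<inter> A))" "Y \<subseteq> B - C" "Y \<inter> T = {}"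
      using ex_finite_disjoint_subset[OF inf T(1)] by blast
    have "k * card ((T \<union> Y) \<inter> A') < card ((T \<union> Y) \<inter> B')" if p: "(A', B') \<in> S" for A' B'
    proof -
      have "(T \<union> Y) \<inter> A' = T \<inter> A'" using p Y(3) unfolding C_def by fastforce
      moreover have "card (T \<inter> B') \<le> card ((T \<union> Y) \<inter> B')"
        using T(1) Y(1) by (intro card_mono) auto
      moreover have "card Y \<le> card ((T \<union> Y) \<inter> B)"
        using T(1) Y by (intro card_mono) auto
      ultimately show ?thesis
        using T(3) p Y(2) by (cases "(A', B') = (A, B)") force+
    qed
    then show ?thesis using T Y by (intro exI[of _ "T \<union> Y"]) auto
  qed
qed

text \<open>
  After separating the given pairs, points outside of all the small sets \<open>A\<close> are added, first to
  \<open>E - L\<close> and \<open>H - E\<close> until these balance and dominate \<open>L\<close>, and then outside of \<open>H\<close>.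
\<close>

lemma ex_finite_balanced:
  fixes S :: "('v set \<times> 'v set) set"
  assumes S: "finite S" "\<And>A B. (A, B) \<in> S \<Longrightarrow> infinite B \<and> A \<prec> B" and X: "finite X"
    and sub: "L \<subseteq> E" "E \<subseteq> H" and inf: "infinite (UNIV :: 'v set)"
    and large: "(UNIV :: 'v set) \<lesssim> E - L" "(UNIV :: 'v set) \<lesssim> H - E" "(UNIV :: 'v set) \<lesssim> - H"
  shows "\<exists>T. finite T \<and> X \<subseteq> T \<and> (\<forall>(A, B)\<in>S. k * card (T \<inter> A) < card (T \<inter> B)) \<and>
    k * card (T \<inter> H) < card T \<and> card (T \<inter> H) = 2 * card (T \<inter> E) \<and>
    k * card (T \<inter> L) < card (T \<inter> H)"
proof -
  define C where "C = (\<Union>p\<in>S. fst p)"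
  have "A \<prec> (UNIV :: 'v set)" if "(A, B) \<in> S" for A B
    using S(2)[OF that] subset_imp_lepoll[of B UNIV] lesspoll_trans2 by blast
  then have C: "C \<prec> (UNIV :: 'v set)"
    unfolding C_def using S(1) inf by (intro UN_finite_lesspoll) auto
  \<comment> \<open>A class as large as the universe keeps infinitely many points outside of all the
    small classes together.\<close>
  have infD: "infinite (D - C)" if "(UNIV :: 'v set) \<lesssim> D" for D
  proof (rule infinite_Diff_lesspoll)
    show "infinite D" using that inf infinite_le_lepoll lepoll_trans by blast
    show "C \<prec> D" using C that by (rule lesspoll_trans2)
  qed
  obtain T where T: "finite T" "X \<subseteq> T" "\<forall>(A, B)\<in>S. k * card (T \<inter> A) < card (T \<inter> B)"
    using ex_finite_separating[OF S X] by blast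
  define a b l where "a = card (T \<inter> E)" and "b = card (T \<inter> (H - E))" and "l = card (T \<inter> L)"
  \<comment> \<open>\<open>T \<inter> E\<close> and \<open>T \<inter> (H - E)\<close> are both
    filled up to the size \<open>N\<close>. It exceeds \<open>a\<close> and \<open>b\<close>, so the
    subtractions below do not truncate, and it exceeds \<open>k * l\<close>, so \<open>L\<close>
    remains negligible in \<open>H\<close>.\<close>
  define N where "N = Suc (k * l + a + b)"
  obtain Y where Y: "finite Y" "card Y = N - a" "Y \<subseteq> E - L - C" "Y \<inter> T = {}"
    using ex_finite_disjoint_subset[OF infD[OF large(1)] T(1)] by blast
  obtain Z where Z: "finite Z" "card Z = N - b" "Z \<subseteq> H - E - C" "Z \<inter> T = {}"
    using ex_finite_disjoint_subset[OF infD[OF large(2)] T(1)] by blast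
  \<comment> \<open>The final count on \<open>H\<close> is \<open>2 * N\<close>; \<open>W\<close>
    alone exceeds \<open>k\<close> times that.\<close>
  obtain W where W: "finite W" "card W = Suc (k * (2 * N))" "W \<subseteq> - H - C" "W \<inter> T = {}"
    using ex_finite_disjoint_subset[OF infD[OF large(3)] T(1)] by blast
  define R where "R = T \<union> Y \<union> Z \<union> W"
  have R: "finite R" using T Y Z W by (simp add: R_def)
  have "R \<inter> E = (T \<inter> E) \<union> Y" using Y(3) Z(3) W(3) sub by (auto simp: R_def)
  moreover have "(T \<inter> E) \<inter> Y = {}" using Y(4) by blast
  ultimately have cE: "card (R \<inter> E) = N"
    using T(1) Y(1,2) by (simp add: card_Un_disjoint a_def[symmetric] N_def)
  have "R \<inter> H = (R \<inter> E) \<union> ((T \<inter> (H - E)) \<union> Z)"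
    using Y(3) Z(3) W(3) sub by (auto simp: R_def)
  moreover have "(R \<inter> E) \<inter> ((T \<inter> (H - E)) \<union> Z) = {}" "(T \<inter> (H - E)) \<inter> Z = {}"
    using Z(3,4) by blast+
  ultimately have cH: "card (R \<inter> H) = 2 * N"
    using T(1) Z(1,2) R cE by (simp add: card_Un_disjoint b_def[symmetric] N_def)
  have "R \<inter> L = T \<inter> L" using Y(3) Z(3) W(3) sub by (auto simp: R_def)
  then have cL: "card (R \<inter> L) = l" by (simp add: l_def)
  have "card W \<le> card R" using R by (intro card_mono) (auto simp: R_def)
  moreover have "k * card (R \<inter> A) < card (R \<inter> B)" if "(A, B) \<in> S" for A B
  proof -
    have "R \<inter> A = T \<inter> A" using that Y(3) Z(3) W(3) by (fastforce simp: R_def C_def)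
    moreover have "card (T \<inter> B) \<le> card (R \<inter> B)" using R by (intro card_mono) (auto simp: R_def)
    ultimately show ?thesis using T(3) that by fastforce
  qed
  ultimately show ?thesis
    using R T(2) cE cH cL W(2) by (intro exI[of _ R]) (auto simp: R_def N_def)
qed


section \<open>The size of the class of ordinals\<close>

context zfc_universe
begin

section \<open>Classes that are sets\<close>

definition elems :: "'v \<Rightarrow> 'v set" where
  "elems x = {z. mem z x}"

definition is_set :: "'v set \<Rightarrow> bool" where
  "is_set C \<longleftrightarrow> (\<exists>x. elems x = C)"

lemma mem_elems [simp]: "z \<in> elems x \<longleftrightarrow> mem z x"
  by (simp add: elems_def)

lemma is_setI: "(\<And>z. mem z x \<longleftrightarrow> z \<in> C) \<Longrightarrow> is_set C"
  unfolding is_set_def elems_def by blast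

lemma is_set_elems: "is_set (elems x)"
  by (auto simp: is_set_def)

lemma is_set_subset:
  assumes "is_set C" "D \<subseteq> C"
  shows "is_set D"
proof -
  obtain x where "elems x = C" using assms(1) by (auto simp: is_set_def)
  moreover obtain s where "\<forall>z. mem z s \<longleftrightarrow> mem z x \<and> z \<in> D" using separation by blast
  ultimately show ?thesis using assms(2) by (intro is_setI[of s]) auto
qed

lemma is_set_image:
  assumes "is_set C"
  shows "is_set (F ` C)"
proof -
  obtain x where "elems x = C" using assms by (auto simp: is_set_def)
  moreover obtain r where "\<forall>z. mem z r \<longleftrightarrow> (\<exists>y. mem y x \<and> z = F y)" using replacement by blast
  ultimately show ?thesis by (intro is_setI[of r]) auto
qed

text \<open>Limitation of size: \<open>C\<close> is covered by an image of \<open>D\<close>, so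
  replacement and separation apply.\<close>

lemma is_set_lepoll:
  assumes "C \<lesssim> D" "is_set D"
  shows "is_set C"
proof -
  obtain g where "C \<subseteq> g ` D" using assms(1) unfolding lepoll_iff by blast
  with is_set_image[OF assms(2)] show ?thesis by (rule is_set_subset)
qed

lemma is_set_UN:
  assumes "is_set C" "\<And>x. x \<in> C \<Longrightarrow> is_set (D x)"
  shows "is_set (\<Union>x\<in>C. D x)"
proof -
  obtain F where F: "\<And>x. x \<in> C \<Longrightarrow> elems (F x) = D x"
    using assms(2) unfolding is_set_def by metis
  obtain y where y: "elems y = F ` C" using is_set_image[OF assms(1)] is_set_def by blast
  obtain u where "\<forall>z. mem z u \<longleftrightarrow> (\<exists>w. mem w y \<and> mem z w)" using union by blast
  moreover have "mem w y \<longleftrightarrow> w \<in> F ` C" for w using y by (simp flip: mem_elems)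
  moreover have "mem z (F x) \<longleftrightarrow> z \<in> D x" if "x \<in> C" for x z
    using F[OF that] by (simp flip: mem_elems)
  ultimately have "mem z u \<longleftrightarrow> z \<in> (\<Union>x\<in>C. D x)" for z by auto
  then show ?thesis by (rule is_setI)
qed

lemma is_set_subsets: "is_set {z. elems z \<subseteq> elems x}"
proof -
  obtain p where "\<forall>z. mem z p \<longleftrightarrow> (\<forall>y. mem y z \<longrightarrow> mem y x)" using powerset by blast
  then show ?thesis by (intro is_setI[of p]) auto
qed

lemma is_set_insert:
  assumes "is_set C"
  shows "is_set (insert x C)"
proof -
  obtain c where c: "elems c = C" using assms is_set_def by blast
  obtain s where s: "\<forall>z. mem z s \<longleftrightarrow> z = x \<or> z = x" using pairing by blast
  obtain p where p: "\<forall>z. mem z p \<longleftrightarrow> z = s \<or> z = c" using pairing by blast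
  obtain u where u: "\<forall>z. mem z u \<longleftrightarrow> (\<exists>y. mem y p \<and> mem z y)" using union by blast
  have "mem z c \<longleftrightarrow> z \<in> C" for z using c by (simp flip: mem_elems)
  then show ?thesis using s p u by (intro is_setI[of u]) auto
qed

section \<open>Successors, ordinals and the size of their class\<close>

lemma wf_mem: "wf {(y, x). mem y x}"
  unfolding wf_eq_minimal using foundation by (simp, blast)

lemma mem_asym: "mem x y \<Longrightarrow> \<not> mem y x"
  using wf_asym[OF wf_mem, of x y] by simp

lemma mem_set_succ [simp]: "mem z (set_succ mem x) \<longleftrightarrow> mem z x \<or> z = x"
proof -
  obtain s where s: "elems s = insert x (elems x)"
    using is_set_insert[OF is_set_elems] is_set_def by blast
  then have "mem z s \<longleftrightarrow> mem z x \<or> z = x" for z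
    by (metis insert_iff mem_elems)
  then have "\<exists>!s. \<forall>z. mem z s \<longleftrightarrow> mem z x \<or> z = x"
    by (intro ex1I[of _ s]) (auto intro: extensionality)
  from theI'[OF this] show ?thesis by (simp add: set_succ_def)
qed

text \<open>Distinct \<open>x\<close> and \<open>y\<close> with the same successor would be members
  of each other, against foundation.\<close>

lemma set_succ_inject [simp]: "set_succ mem x = set_succ mem y \<longleftrightarrow> x = y"
proof
  assume "set_succ mem x = set_succ mem y"
  then have "mem z x \<or> z = x \<longleftrightarrow> mem z y \<or> z = y" for z
    using mem_set_succ by metis
  then show "x = y" using mem_asym by blast
qed simp

lemma set_succ_notin_Zero: "set_succ mem x \<notin> Zero mem"
  by (auto simp: Zero_def)

lemma ex_Zero: "\<exists>x. x \<in> Zero mem"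
  using infinity by (auto simp: Zero_def)

lemma Zero_subset_On: "Zero mem \<subseteq> On mem"
  by (auto simp: Zero_def On_def transitive_set_def)

lemma set_succ_On:
  assumes "\<alpha> \<in> On mem"
  shows "set_succ mem \<alpha> \<in> On mem"
proof -
  have "transitive_set mem \<alpha>" "\<And>\<beta>. mem \<beta> \<alpha> \<Longrightarrow> transitive_set mem \<beta>"
    using assms by (auto simp: On_def)
  moreover from this(1) have "transitive_set mem (set_succ mem \<alpha>)"
    by (auto simp: transitive_set_def)
  ultimately show ?thesis by (auto simp: On_def)
qed

lemma set_succ_funpow_On: "\<alpha> \<in> On mem \<Longrightarrow> (set_succ mem ^^ n) \<alpha> \<in> On mem"
  by (induction n) (auto simp: set_succ_On)

text \<open>The bound is the union of the successors of the values; taking successors makes it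
  strict.\<close>

lemma ex_On_bound:
  assumes "is_set C" "\<And>x. x \<in> C \<Longrightarrow> f x \<in> On mem"
  shows "\<exists>\<alpha>\<in>On mem. \<forall>x\<in>C. mem (f x) \<alpha>"
proof -
  have "is_set (\<Union>x\<in>C. elems (set_succ mem (f x)))"
    by (intro is_set_UN assms(1) is_set_elems)
  then obtain \<alpha> where "elems \<alpha> = (\<Union>x\<in>C. elems (set_succ mem (f x)))"
    unfolding is_set_def ..
  then have \<alpha>: "mem z \<alpha> \<longleftrightarrow> (\<exists>x\<in>C. mem z (set_succ mem (f x)))" for z
    unfolding elems_def by blast
  have "set_succ mem (f x) \<in> On mem" if "x \<in> C" for x using assms(2) that set_succ_On by blast
  then have trans: "transitive_set mem (set_succ mem (f x))"
      "\<And>\<beta>. mem \<beta> (set_succ mem (f x)) \<Longrightarrow> transitive_set mem \<beta>" if "x \<in> C" for x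
    using that by (auto simp only: On_def)
  have "transitive_set mem \<alpha>"
    unfolding transitive_set_def
  proof (intro allI impI)
    fix y z assume "mem y \<alpha>" and zy: "mem z y"
    then obtain x where x: "x \<in> C" "mem y (set_succ mem (f x))" using \<alpha> by blast
    then have "mem z (set_succ mem (f x))"
      using trans(1)[OF x(1)] zy unfolding transitive_set_def by blast
    then show "mem z \<alpha>" using \<alpha> x(1) by blast
  qed
  moreover have "transitive_set mem \<beta>" if "mem \<beta> \<alpha>" for \<beta>
    using that \<alpha> trans(2) by blast
  ultimately have "\<alpha> \<in> On mem" by (simp add: On_def)
  then show ?thesis using \<alpha> by auto
qed

text \<open>The Burali-Forti argument: a strict bound for all ordinals would be a member of
  itself.\<close>

lemma not_is_set_On: "\<not> is_set (On mem)"
  using ex_On_bound[of "On mem" "\<lambda>x. x"] mem_asym by blast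

text \<open>Otherwise comparability would embed \<open>On mem\<close> into a set and thereby make it
  a set.\<close>

lemma elems_lepoll_On: "elems x \<lesssim> On mem"
proof (rule ccontr)
  assume "\<not> elems x \<lesssim> On mem"
  then have "On mem \<lesssim> elems x" by (simp add: not_lepoll_iff_lesspoll lesspoll_imp_lepoll)
  then show False using is_set_lepoll is_set_elems not_is_set_On by blast
qed

text \<open>Successor is an injection of the ordinals into themselves which misses zero.\<close>

lemma infinite_On: "infinite (On mem)"
proof
  assume "finite (On mem)"
  then have "set_succ mem ` On mem = On mem"
    by (rule endo_inj_surj) (auto simp: set_succ_On inj_on_def)
  moreover obtain z where "z \<in> Zero mem" using ex_Zero by blast
  ultimately have "z \<in> set_succ mem ` On mem" using Zero_subset_On by blast
  then show False using \<open>z \<in> Zero mem\<close> set_succ_notin_Zero by blast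
qed

text \<open>Recursion along membership, choosing at \<open>x\<close> any ordinal above the values at
  its elements. This need not be the usual rank, which takes the least one.\<close>

lemma ex_rank: "\<exists>f. \<forall>x. f x \<in> On mem \<and> (\<forall>y. mem y x \<longrightarrow> mem (f y) (f x))"
proof (rule dependent_wf_choice[OF wf_mem])
  fix x f
  assume "\<And>y. (y, x) \<in> {(y, x). mem y x} \<Longrightarrow> f y \<in> On mem \<and> (\<forall>z. mem z y \<longrightarrow> mem (f z) (f y))"
  then show "\<exists>r. r \<in> On mem \<and> (\<forall>y. mem y x \<longrightarrow> mem (f y) r)"
    using ex_On_bound[OF is_set_elems[of x], of f] by auto
qed auto

text \<open>
  The levels of a rank function are sets, hence no larger than \<open>On\<close>, so \<open>V\<close> is a union of
  \<open>On\<close> many classes of size at most \<open>On\<close>.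
\<close>

lemma UNIV_lepoll_On: "(UNIV :: 'v set) \<lesssim> On mem"
proof -
  obtain f where f: "\<And>x. f x \<in> On mem" "\<And>x y. mem y x \<Longrightarrow> mem (f y) (f x)"
    using ex_rank by blast
  \<comment> \<open>If \<open>f x\<close> is some \<open>\<beta>\<close> in \<open>\<alpha>\<close>,
    all elements of \<open>x\<close> lie in the level of \<open>\<beta>\<close>. So the level of
    \<open>\<alpha>\<close> is covered by the power sets of the earlier levels.\<close>
  have level: "is_set {x. mem (f x) \<alpha>}" for \<alpha>
  proof (induction \<alpha> rule: wf_induct_rule[OF wf_mem])
    case (1 \<alpha>)
    then have "\<forall>\<beta>. \<exists>v. mem \<beta> \<alpha> \<longrightarrow> elems v = {x. mem (f x) \<beta>}" by (auto simp: is_set_def)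
    then obtain v where v: "\<And>\<beta>. mem \<beta> \<alpha> \<Longrightarrow> elems (v \<beta>) = {x. mem (f x) \<beta>}" by metis
    have "is_set (\<Union>\<beta>\<in>elems \<alpha>. {x. elems x \<subseteq> elems (v \<beta>)})"
      by (intro is_set_UN is_set_elems is_set_subsets)
    then show ?case
      by (rule is_set_subset) (use v f(2) in auto)
  qed
  have "ordLeq3 (card_of (\<Union>\<alpha>\<in>On mem. {x. mem (f x) \<alpha>})) (card_of (On mem))"
  proof (rule card_of_UNION_ordLeq_infinite[OF infinite_On])
    show "\<forall>\<alpha>\<in>On mem. ordLeq3 (card_of {x. mem (f x) \<alpha>}) (card_of (On mem))"
      using level elems_lepoll_On unfolding is_set_def lepoll_iff_card_of by metis
  qed (simp flip: lepoll_iff_card_of)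
  \<comment> \<open>Levels are strict, so \<open>x\<close> first appears at the successor of
    \<open>f x\<close>.\<close>
  moreover have "x \<in> (\<Union>\<alpha>\<in>On mem. {x. mem (f x) \<alpha>})" for x
    using f(1) set_succ_On by (intro UN_I[of "set_succ mem (f x)"]) auto
  then have "(\<Union>\<alpha>\<in>On mem. {x. mem (f x) \<alpha>}) = UNIV" by blast
  ultimately show ?thesis by (simp add: lepoll_iff_card_of)
qed

section \<open>Parity of ordinals\<close>

lemma Limits_subset_Even: "Limits mem \<subseteq> Even mem"
proof
  fix \<delta> assume "\<delta> \<in> Limits mem"
  then show "\<delta> \<in> Even mem" unfolding Even_def by (auto intro!: exI[of _ \<delta>] exI[of _ 0])
qed

lemma Zero_Limits_subset_On: "Zero mem \<union> Limits mem \<subseteq> On mem"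
  using Zero_subset_On by (auto simp: Limits_def)

lemma Even_subset_On: "Even mem \<subseteq> On mem"
  using Zero_Limits_subset_On by (auto simp: Even_def intro!: set_succ_funpow_On)

lemma Zero_Limits_neq_set_succ:
  "\<delta> \<in> Zero mem \<union> Limits mem \<Longrightarrow> \<alpha> \<in> On mem \<Longrightarrow> \<delta> \<noteq> set_succ mem \<alpha>"
  using set_succ_notin_Zero by (auto simp: Limits_def)

text \<open>Successors are stripped from both sides by injectivity. When one side runs out, its base
  is no successor, so the other side has run out too. Hence parity is well defined.\<close>

lemma set_succ_funpow_unique:
  assumes "\<delta> \<in> Zero mem \<union> Limits mem" "\<gamma> \<in> Zero mem \<union> Limits mem"
    "(set_succ mem ^^ m) \<delta> = (set_succ mem ^^ n) \<gamma>"
  shows "m = n"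
  using assms(3)
proof (induction m arbitrary: n)
  case 0
  have "(set_succ mem ^^ k) \<gamma> \<in> On mem" for k
    using assms(2) Zero_Limits_subset_On set_succ_funpow_On by blast
  then show ?case
    using 0 Zero_Limits_neq_set_succ[OF assms(1)] by (cases n) auto
next
  case (Suc m)
  have "(set_succ mem ^^ m) \<delta> \<in> On mem"
    using assms(1) Zero_Limits_subset_On set_succ_funpow_On by blast
  then show ?case
    using Suc Zero_Limits_neq_set_succ[OF assms(2)] by (cases n) force+
qed

text \<open>Removing successors moves down along membership, so by foundation it ends at zero or a
  limit.\<close>

lemma On_cases:
  assumes "\<alpha> \<in> On mem"
  obtains \<delta> n where "\<delta> \<in> Zero mem \<union> Limits mem" "\<alpha> = (set_succ mem ^^ n) \<delta>"
proof -
  have "\<exists>\<delta>\<in>Zero mem \<union> Limits mem. \<exists>n. \<alpha> = (set_succ mem ^^ n) \<delta>"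
    using assms
  proof (induction \<alpha> rule: wf_induct_rule[OF wf_mem])
    case (1 \<alpha>)
    show ?case
    proof (cases "\<alpha> \<in> Zero mem \<union> Limits mem")
      case True
      then show ?thesis by (intro bexI[of _ \<alpha>] exI[of _ 0]) auto
    next
      case False
      then obtain \<beta> where \<beta>: "\<beta> \<in> On mem" "\<alpha> = set_succ mem \<beta>"
        using 1(2) by (auto simp: Limits_def)
      then obtain \<delta> n where "\<delta> \<in> Zero mem \<union> Limits mem" "\<beta> = (set_succ mem ^^ n) \<delta>"
        using 1(1)[of \<beta>] by auto
      then show ?thesis using \<beta> by (intro bexI[of _ \<delta>] exI[of _ "Suc n"]) auto
    qed
  qed
  then show thesis using that by blast
qed

lemma set_succ_notin_Even:
  assumes "\<alpha> \<in> Even mem"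
  shows "set_succ mem \<alpha> \<notin> Even mem"
proof
  obtain \<delta> n where \<delta>: "\<delta> \<in> Zero mem \<union> Limits mem" "\<alpha> = (set_succ mem ^^ (2 * n)) \<delta>"
    using assms by (auto simp: Even_def)
  assume "set_succ mem \<alpha> \<in> Even mem"
  then obtain \<gamma> m where "\<gamma> \<in> Zero mem \<union> Limits mem"
    "set_succ mem \<alpha> = (set_succ mem ^^ (2 * m)) \<gamma>"
    by (auto simp: Even_def)
  then have "Suc (2 * n) = 2 * m"
    using \<delta> by (intro set_succ_funpow_unique) auto
  then show False by presburger
qed

lemma set_succ_in_Even:
  assumes "\<alpha> \<in> On mem - Even mem"
  shows "set_succ mem \<alpha> \<in> Even mem"
proof -
  obtain \<delta> n where \<delta>: "\<delta> \<in> Zero mem \<union> Limits mem" "\<alpha> = (set_succ mem ^^ n) \<delta>"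
    using assms On_cases by blast
  then have "odd n" using assms by (auto simp: Even_def elim!: evenE)
  then obtain m where "Suc n = 2 * m" by (metis even_Suc evenE)
  then have "set_succ mem \<alpha> = (set_succ mem ^^ (2 * m)) \<delta>"
    using \<delta>(2) by (metis comp_apply funpow.simps(2))
  then show ?thesis using \<delta>(1) unfolding Even_def by blast
qed

lemma Even_lepoll_odd: "Even mem \<lesssim> On mem - Even mem"
  unfolding lepoll_def using set_succ_notin_Even Even_subset_On set_succ_On
  by (intro exI[of _ "set_succ mem"]) (auto simp: inj_on_def)

text \<open>Successor turns odd into even, and its values are never limits.\<close>

lemma odd_lepoll_Even_Diff_Limits: "On mem - Even mem \<lesssim> Even mem - Limits mem"
  unfolding lepoll_def using set_succ_in_Even
  by (intro exI[of _ "set_succ mem"]) (auto simp: inj_on_def Limits_def)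

text \<open>Successor embeds the even ordinals into the odd ones. If the odd ones were fewer than
  all ordinals, both halves would be, and hence their union \<open>On mem\<close> would be smaller
  than itself.\<close>

lemma UNIV_lepoll_odd: "(UNIV :: 'v set) \<lesssim> On mem - Even mem"
proof (rule ccontr)
  assume "\<not> (UNIV :: 'v set) \<lesssim> On mem - Even mem"
  then have odd: "On mem - Even mem \<prec> On mem"
    unfolding not_lepoll_iff_lesspoll using UNIV_lepoll_On by (rule lesspoll_trans2)
  with Even_lepoll_odd have "Even mem \<prec> On mem" by (rule lesspoll_trans1)
  then have "(On mem - Even mem) \<union> Even mem \<prec> On mem"
    by (intro Un_lesspoll infinite_On odd)
  then show False using Even_subset_On by (simp add: Un_absorb2)
qed

lemma UNIV_lepoll_Even_Diff_Limits: "(UNIV :: 'v set) \<lesssim> Even mem - Limits mem"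
  using UNIV_lepoll_odd odd_lepoll_Even_Diff_Limits by (rule lepoll_trans)

text \<open>The sets \<open>{{x}}\<close> are not transitive.\<close>

lemma UNIV_lepoll_Compl_On: "(UNIV :: 'v set) \<lesssim> - On mem"
proof -
  have "\<forall>x. \<exists>p. \<forall>z. mem z p \<longleftrightarrow> z = x" using pairing[of x x for x] by simp
  then obtain s where s: "\<And>x z. mem z (s x) \<longleftrightarrow> z = x" by metis
  have "s (s x) \<notin> On mem" for x
  proof
    assume "s (s x) \<in> On mem"
    then have "mem x (s (s x))" using s unfolding On_def transitive_set_def by blast
    then have "mem x x" using s by metis
    then show False using mem_asym by blast
  qed
  moreover have "inj (\<lambda>x. s (s x))" using s by (intro injI) metis
  ultimately show ?thesis unfolding lepoll_def by (intro exI[of _ "\<lambda>x. s (s x)"]) auto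
qed

end


section \<open>The ultrafilter\<close>

text \<open>Zorn's lemma for the proper filters below \<open>F\<close>, with the order reversed so
  that finer filters are larger. A maximal one is an ultrafilter.\<close>

lemma ex_ultrafilter_le:
  assumes "F \<noteq> bot"
  obtains U where "U \<le> F" "ultrafilter U"
proof -
  define \<A> where "\<A> = {G. G \<noteq> bot \<and> G \<le> F}"
  have "\<exists>U\<in>\<A>. \<forall>G\<in>\<A>. G \<le> U \<longrightarrow> G = U"
  proof (rule predicate_Zorn)
    show "partial_order_on \<A> (relation_of (\<lambda>G H. H \<le> G) \<A>)"
      by (rule partial_order_on_relation_ofI) auto
    show "\<exists>U\<in>\<A>. \<forall>G\<in>\<C>. U \<le> G" if ch: "\<C> \<in> Chains (relation_of (\<lambda>G H. H \<le> G) \<A>)" for \<C>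
    proof (cases "\<C> = {}")
      case True
      then show ?thesis using assms by (auto simp: \<A>_def)
    next
      case False
      have sub: "\<C> \<subseteq> \<A>" and chain: "G \<le> H \<or> H \<le> G" if "G \<in> \<C>" "H \<in> \<C>" for G H
        using ch that by (auto simp: Chains_def relation_of_def)
      \<comment> \<open>Members of a chain form a base of its infimum, which is therefore
        proper.\<close>
      have "eventually P (Inf \<C>) \<longleftrightarrow> (\<exists>G\<in>\<C>. eventually P G)" for P
        using False chain by (intro eventually_Inf_base) (auto simp: le_inf_iff)
      then have "Inf \<C> \<noteq> bot"
        using sub False by (auto simp: trivial_limit_def \<A>_def)
      moreover have "Inf \<C> \<le> F"
        using sub False by (auto simp: \<A>_def intro: Inf_lower2)
      ultimately show ?thesis by (intro bexI[of _ "Inf \<C>"]) (auto simp: \<A>_def Inf_lower)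
    qed
  qed
  then obtain U where U: "U \<noteq> bot" "U \<le> F" and min: "\<And>G. G \<noteq> bot \<Longrightarrow> G \<le> U \<Longrightarrow> G = U"
    unfolding \<A>_def by (auto dest: order_trans)
  \<comment> \<open>Adjoining \<open>P\<close> gives a proper filter, which equals \<open>U\<close>
    by minimality.\<close>
  have "eventually P U" if "\<not> eventually (\<lambda>x. \<not> P x) U" for P
  proof -
    have "inf U (principal {x. P x}) = U"
      using that by (intro min) (auto simp: trivial_limit_def eventually_inf_principal)
    moreover have "eventually P (inf U (principal {x. P x}))"
      by (simp add: eventually_inf_principal)
    ultimately show ?thesis by simp
  qed
  then show thesis using that[OF U(2)] U(1) by (auto simp: ultrafilter_def)
qed

section \<open>From hyper-rationals to counting\<close>

lemma Pr_eq_hrat: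
  "Pr U \<theta> A = hrat U (\<lambda>T. of_nat (card (fset T \<inter> \<theta> -` A)) / of_nat (card (fset T)))"
proof -
  have "fset T \<inter> \<theta> -` A = {s. \<theta> s \<in> A} \<inter> fset T" for T by auto
  then show ?thesis by (simp add: Pr_def fcard.rep_eq ffilter.rep_eq)
qed

text \<open>Where \<open>T\<close> is empty, both quotients are \<open>0\<close>.\<close>

lemma hdivide_Pr:
  "hdivide U (Pr U \<theta> A) (Pr U \<theta> B) =
    hrat U (\<lambda>T. of_nat (card (fset T \<inter> \<theta> -` A)) / of_nat (card (fset T \<inter> \<theta> -` B)))"
  unfolding Pr_eq_hrat hdivide_hrat
  by (intro hrat_eqI always_eventually) (auto simp: divide_simps)

lemma happrox_hconst:
  "happrox U (hrat U f) (hconst U c) \<longleftrightarrow>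
    (\<forall>n>0. \<forall>\<^sub>F T in U. \<bar>f T - c\<bar> < 1 / of_nat n)"
  by (simp add: happrox_def hconst_def hminus_hrat habs_hrat hless_hrat)

text \<open>Clearing denominators turns being infinitesimal into inequalities between counts, the
  form in which the finite sets are constructed.\<close>

lemma happrox_ratio_0:
  assumes "\<And>n. \<forall>\<^sub>F T in U. n * a T < (b T :: nat)"
  shows "happrox U (hrat U (\<lambda>T. of_nat (a T) / of_nat (b T))) (hconst U 0)"
  unfolding happrox_hconst
proof (intro allI impI)
  fix n :: nat assume n: "0 < n"
  from assms[of n] show "\<forall>\<^sub>F T in U. \<bar>of_nat (a T) / of_nat (b T) - 0 :: rat\<bar> < 1 / of_nat n"
  proof eventually_elim
    case (elim T)
    then have "of_nat n * of_nat (a T) < (of_nat (b T) :: rat)"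
      by (metis of_nat_less_iff of_nat_mult)
    moreover have "0 < (of_nat (b T) :: rat)" using elim by simp
    ultimately show ?case using n by (simp add: field_simps)
  qed
qed

lemma hmuch_less_Pr:
  assumes "\<And>n. \<forall>\<^sub>F T in U. n * card (fset T \<inter> \<theta> -` A) < card (fset T \<inter> \<theta> -` B)"
  shows "hmuch_less U (Pr U \<theta> A) (Pr U \<theta> B)"
proof -
  have "\<forall>\<^sub>F T in U. (0 :: rat) < of_nat (card (fset T \<inter> \<theta> -` B)) / of_nat (card (fset T))"
    \<comment> \<open>For the factor \<open>0\<close> the assumption says that the count for
      \<open>B\<close> is positive.\<close>
    using assms[of 0]
  proof eventually_elim
    case (elim T)
    then have "card (fset T) > 0" by (auto simp: card_gt_0_iff)
    then show ?case using elim by simp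
  qed
  then show ?thesis
    unfolding hmuch_less_def hdivide_Pr using happrox_ratio_0[OF assms]
    by (simp add: Pr_eq_hrat hconst_def hless_hrat)
qed

text \<open>The sets \<open>G i\<close> are nonempty by \<open>ex_finite_balanced\<close> and
  directed downwards, because two indices combine by unions and the maximum. They generate a proper
  filter, which some ultrafilter refines.\<close>

lemma ex_ultrafilter_balanced:
  fixes L E H :: "'v set"
  assumes sub: "L \<subseteq> E" "E \<subseteq> H" and inf: "infinite (UNIV :: 'v set)"
    and large: "(UNIV :: 'v set) \<lesssim> E - L" "(UNIV :: 'v set) \<lesssim> H - E" "(UNIV :: 'v set) \<lesssim> - H"
  obtains U :: "'v fset filter" where "ultrafilter U" "fine U"
    "\<And>A B k. infinite B \<Longrightarrow> A \<prec> B \<Longrightarrow>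
      \<forall>\<^sub>F T in U. k * card (fset T \<inter> A) < card (fset T \<inter> B)"
    "\<And>k. \<forall>\<^sub>F T in U. k * card (fset T \<inter> H) < card (fset T)"
    "\<forall>\<^sub>F T in U. card (fset T \<inter> H) = 2 * card (fset T \<inter> E)"
    "\<And>k. \<forall>\<^sub>F T in U. k * card (fset T \<inter> L) < card (fset T \<inter> H)"
proof -
  \<comment> \<open>In an index \<open>(X, S, k)\<close>, \<open>X\<close> serves fineness,
    \<open>S\<close> serves superregularity, and \<open>k\<close> is the factor in all
    inequalities.\<close>
  define I where "I = {(X, S, k). finite X \<and> finite S \<and>
    (\<forall>(A, B)\<in>S. infinite B \<and> A \<prec> B)} \<inter> (UNIV :: ('v set \<times> ('v set \<times> 'v set) set \<times> nat) set)"
  define G where "G = (\<lambda>(X, S, k). {T. X \<subseteq> fset T \<and>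
    (\<forall>(A, B)\<in>S. k * card (fset T \<inter> A) < card (fset T \<inter> B)) \<and>
    k * card (fset T \<inter> H) < card (fset T) \<and> card (fset T \<inter> H) = 2 * card (fset T \<inter> E) \<and>
    k * card (fset T \<inter> L) < card (fset T \<inter> H)})"
  have G_nonempty: "G i \<noteq> {}" if "i \<in> I" for i
  proof -
    obtain X S k where i: "i = (X, S, k)" by (cases i)
    have S: "finite X" "finite S" "\<And>A B. (A, B) \<in> S \<Longrightarrow> infinite B \<and> A \<prec> B"
      using that i by (auto simp: I_def)
    obtain R where "finite R" and R: "X \<subseteq> R" "\<forall>(A, B)\<in>S. k * card (R \<inter> A) < card (R \<inter> B)"
      "k * card (R \<inter> H) < card R" "card (R \<inter> H) = 2 * card (R \<inter> E)"
      "k * card (R \<inter> L) < card (R \<inter> H)"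
      using ex_finite_balanced[OF S(2,3,1) sub inf large, of k] by blast
    then have "fset (Abs_fset R) = R" by (simp add: Abs_fset_inverse)
    then have "Abs_fset R \<in> G i" using R by (simp add: G_def i)
    then show ?thesis by blast
  qed
  have antitone: "G (X', S', k') \<subseteq> G (X, S, k)" if "X \<subseteq> X'" "S \<subseteq> S'" "k \<le> k'" for X X' S S' k k'
  proof
    fix T assume T: "T \<in> G (X', S', k')"
    have "k * a < b" if "k' * a < b" for a b
      using that \<open>k \<le> k'\<close> by (meson le_less_trans mult_le_mono1)
    then show "T \<in> G (X, S, k)" using T that(1,2) unfolding G_def by blast
  qed
  have directed: "\<exists>h\<in>I. G h \<subseteq> G i \<inter> G j" if "i \<in> I" "j \<in> I" for i j
  proof -
    obtain X S k where i: "i = (X, S, k)" by (cases i)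
    obtain Y S' l where j: "j = (Y, S', l)" by (cases j)
    have "(X \<union> Y, S \<union> S', max k l) \<in> I"
      using that unfolding I_def i j by (simp add: ball_Un)
    moreover have "G (X \<union> Y, S \<union> S', max k l) \<subseteq> G (X, S, k)"
      by (rule antitone) auto
    moreover have "G (X \<union> Y, S \<union> S', max k l) \<subseteq> G (Y, S', l)"
      by (rule antitone) auto
    ultimately show ?thesis unfolding i j by blast
  qed
  define F where "F = (INF i\<in>I. principal (G i))"
  have ev_F: "eventually P F \<longleftrightarrow> (\<exists>i\<in>I. \<forall>T\<in>G i. P T)" for P
    unfolding F_def eventually_principal[symmetric]
  proof (rule eventually_INF_base)
    show "I \<noteq> {}" by (auto simp: I_def)
  qed (use directed in simp)
  have "F \<noteq> bot" unfolding trivial_limit_def ev_F using G_nonempty by blast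
  then obtain U where U: "U \<le> F" "ultrafilter U" by (rule ex_ultrafilter_le)
  have ev: "eventually P U" if "i \<in> I" "\<And>T. T \<in> G i \<Longrightarrow> P T" for P i
  proof (rule filter_leD[OF U(1)])
    show "eventually P F" using that unfolding ev_F by blast
  qed
  show thesis
  proof (rule that[OF U(2)])
    show "fine U" unfolding fine_def
      by (intro allI ev[of "({x}, {}, 0)" for x]) (auto simp: I_def G_def)
    show "\<forall>\<^sub>F T in U. k * card (fset T \<inter> A) < card (fset T \<inter> B)"
      if "infinite B" "A \<prec> B" for A B k
      by (rule ev[of "({}, {(A, B)}, k)"]) (use that in \<open>auto simp: I_def G_def\<close>)
    show "\<forall>\<^sub>F T in U. k * card (fset T \<inter> H) < card (fset T)" for k
      by (rule ev[of "({}, {}, k)"]) (auto simp: I_def G_def)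
    show "\<forall>\<^sub>F T in U. card (fset T \<inter> H) = 2 * card (fset T \<inter> E)"
      by (rule ev[of "({}, {}, 0)"]) (auto simp: I_def G_def)
    show "\<forall>\<^sub>F T in U. k * card (fset T \<inter> L) < card (fset T \<inter> H)" for k
      by (rule ev[of "({}, {}, k)"]) (auto simp: I_def G_def)
  qed
qed

lemma diagonal_imp_bij: "diagonal \<theta> \<Longrightarrow> bij \<theta>"
  by (simp add: diagonal_def bij_iff)

text \<open>\<open>U\<close> is chosen after \<open>\<theta>\<close>. No single \<open>U\<close>
  gives the first property for all diagonal variables: following \<open>\<theta>\<close> by a
  permutation that exchanges \<open>On mem\<close> with its equally large complement yields
  complementary probabilities. Superregularity does range over all of them.\<close>

theorem theorem3:
  fixes mem :: "'v \<Rightarrow> 'v \<Rightarrow> bool" and \<theta> :: "'v \<Rightarrow> 'v"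
  assumes "zfc_universe mem" and "diagonal \<theta>"
  shows "\<exists>U :: 'v fset filter. ultrafilter U \<and> fine U \<and> superregular U \<and>
    happrox U (Pr U \<theta> (On mem)) (hconst U 0) \<and>
    happrox U (cond_Pr U \<theta> (Even mem) (On mem)) (hconst U (1 / 2)) \<and>
    happrox U (cond_Pr U \<theta> (Limits mem) (On mem)) (hconst U 0)"
proof -
  interpret zfc_universe mem by fact
  define L E H where "L = \<theta> -` Limits mem" and "E = \<theta> -` Even mem" and "H = \<theta> -` On mem"
  have large: "(UNIV :: 'v set) \<lesssim> \<theta> -` D" if "(UNIV :: 'v set) \<lesssim> D" for D
    using that eqpoll_sym[OF vimage_bij_eqpoll[OF diagonal_imp_bij[OF assms(2)]]]
    by (rule lepoll_trans2)
  have "L \<subseteq> E" "E \<subseteq> H"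
    using Limits_subset_Even Even_subset_On by (auto simp: L_def E_def H_def)
  moreover have "infinite (UNIV :: 'v set)"
    using infinite_On by (rule contrapos_nn) (rule finite_subset[OF subset_UNIV])
  moreover have "(UNIV :: 'v set) \<lesssim> E - L" "(UNIV :: 'v set) \<lesssim> H - E" "(UNIV :: 'v set) \<lesssim> - H"
    unfolding L_def E_def H_def vimage_Diff[symmetric] vimage_Compl[symmetric]
    by (intro large UNIV_lepoll_Even_Diff_Limits UNIV_lepoll_odd UNIV_lepoll_Compl_On)+
  ultimately obtain U :: "'v fset filter" where U: "ultrafilter U" "fine U"
    and sep: "\<And>A B k. infinite B \<Longrightarrow> A \<prec> B \<Longrightarrow>
      \<forall>\<^sub>F T in U. k * card (fset T \<inter> A) < card (fset T \<inter> B)"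
    and H: "\<And>k. \<forall>\<^sub>F T in U. k * card (fset T \<inter> H) < card (fset T)"
    and E: "\<forall>\<^sub>F T in U. card (fset T \<inter> H) = 2 * card (fset T \<inter> E)"
    and L: "\<And>k. \<forall>\<^sub>F T in U. k * card (fset T \<inter> L) < card (fset T \<inter> H)"
    by (rule ex_ultrafilter_balanced) blast
  \<comment> \<open>\<open>sep\<close> covers all pairs of classes, so it applies to preimages under
    any bijection \<open>\<tau>\<close>, not just under \<open>\<theta>\<close>.\<close>
  have "hmuch_less U (Pr U \<tau> A) (Pr U \<tau> B)"
    if "diagonal \<tau>" "(UNIV :: nat set) \<lesssim> A" "A \<prec> B" for \<tau> and A B :: "'v set"
  proof (rule hmuch_less_Pr, rule sep)
    have vimage: "\<tau> -` D \<approx> D" for D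
      using that(1) by (intro vimage_bij_eqpoll diagonal_imp_bij)
    have "infinite B"
      using that(2,3) lesspoll_imp_infinite infinite_le_lepoll by blast
    then show "infinite (\<tau> -` B)" using eqpoll_finite_iff[OF vimage] by blast
    show "\<tau> -` A \<prec> \<tau> -` B"
      using eq_lesspoll_trans[OF vimage lesspoll_eq_trans[OF that(3) eqpoll_sym[OF vimage]]] .
  qed
  then have "superregular U" by (simp add: superregular_def)
  moreover have "happrox U (Pr U \<theta> (On mem)) (hconst U 0)"
    unfolding Pr_eq_hrat using H by (intro happrox_ratio_0) (simp add: H_def)
  moreover have "happrox U (cond_Pr U \<theta> (Even mem) (On mem)) (hconst U (1 / 2))"
  proof -
    have "\<forall>\<^sub>F T in U. of_nat (card (fset T \<inter> E)) / of_nat (card (fset T \<inter> H)) = (1 / 2 :: rat)"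
      \<comment> \<open>\<open>L[of 0]\<close> makes the denominator positive, so the quotient is
        exactly \<open>1 / 2\<close> and not the default value of \<open>0 / 0\<close>.\<close>
      using E L[of 0] by eventually_elim (auto simp: card_gt_0_iff)
    then have "hdivide U (Pr U \<theta> (Even mem)) (Pr U \<theta> (On mem)) = hconst U (1 / 2)"
      unfolding hdivide_Pr hconst_def E_def H_def by (rule hrat_eqI)
    moreover have "happrox U (hconst U (1 / 2)) (hconst U (1 / 2))"
      by (subst (1) hconst_def) (simp add: happrox_hconst)
    ultimately show ?thesis
      unfolding cond_Pr_def Int_absorb2[OF Even_subset_On] by simp
  qed
  moreover have "happrox U (cond_Pr U \<theta> (Limits mem) (On mem)) (hconst U 0)"
  proof -
    have "Limits mem \<inter> On mem = Limits mem" by (auto simp: Limits_def)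
    then show ?thesis
      unfolding cond_Pr_def hdivide_Pr using L by (intro happrox_ratio_0) (simp add: L_def H_def)
  qed
  ultimately show ?thesis using U by blast
qed

end
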